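(* Let $\mathbf{P}$ be an additive category and let $\overline{\alpha}: (A \xrightarrow{\gamma_A} \Omega_A \xleftarrow{\rho_A} R_A) \to (B \xrightarrow{\gamma_B} \Omega_B \xleftarrow{\rho_B} R_B)$ be an epimorphism in $\mathcal{Q}(\mathbf{P})$. Then there exists a morphism $\begin{pmatrix}\zeta_1 & \zeta_2\end{pmatrix}: B \to R_B\oplus A$ in $\mathbf{P}$ such that $$\gamma_B = \zeta_1\cdot\rho_B + \zeta_2\cdot\alpha\cdot\gamma_B .$$ Moreover, given such a morphism, let $\overline{\tau}: (A \xrightarrow{\gamma_A} \Omega_A \xleftarrow{\rho_A} R_A) \to (T \xrightarrow{\gamma_T} \Omega_T \xleftarrow{\rho_T} R_T)$ be a test morphism, i.e. a morphism in $\mathcal{Q}(\mathbf{P})$ such that for every morphism $\overline{\kappa}$ in $\mathcal{Q}(\mathbf{P})$ with $\overline{\kappa}\cdot\overline{\alpha} = 0$ we also have $\overline{\kappa}\cdot\overline{\tau} = 0$. Then $\zeta_2\cdot\tau: B \to T$ defines a well-defined morphism $\overline{\zeta_2\cdot\tau}: (B \xrightarrow{\gamma_B} \Omega_B \xleftarrow{\rho_B} R_B) \to (T \xrightarrow{\gamma_T} \Omega_T \xleftarrow{\rho_T} R_T)$ in $\mathcal{Q}(\mathbf{P})$ which is a colift of $\overline{\tau}$ along $\overline{\alpha}$, i.e. $\overline{\alpha}\cdot\overline{\zeta_2\cdot\tau} = \overline{\tau}$.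
   Context: Composition is written diagrammatically: for $\alpha: A \to B$ and $\beta: B \to C$, the composite is $\alpha\cdot\beta: A \to C$. The morphism $\begin{pmatrix}\zeta_1 & \zeta_2\end{pmatrix}: B \to X_1\oplus X_2$ has components $\zeta_i: B \to X_i$. A cospan in $\mathbf{P}$ is a pair of morphisms $(A \xrightarrow{\gamma} B \xleftarrow{\rho} C)$ with common codomain. $\mathrm{Syz}(A \xrightarrow{\gamma} B \xleftarrow{\rho} C)$ is the full subcategory of the slice category of $\mathbf{P}$ over $A$ whose objects, called syzygies, are the morphisms $\sigma: S \to A$ for which there exists $\omega: S \to C$ (a syzygy witness) with $\sigma\cdot\gamma = \omega\cdot\rho$. The additive category $\mathrm{Aux}(\mathbf{P})$ has as objects the cospans $(A \xrightarrow{\gamma_A} \Omega_A \xleftarrow{\rho_A} R_A)$ in $\mathbf{P}$; a morphism from $(A \xrightarrow{\gamma_A} \Omega_A \xleftarrow{\rho_A} R_A)$ to $(B \xrightarrow{\gamma_B} \Omega_B \xleftarrow{\rho_B} R_B)$ is a morphism $\alpha: A \to B$ in $\mathbf{P}$ satisfying the well-definedness property: $\sigma \in \mathrm{Syz}(A \xrightarrow{\gamma_A} \Omega_A \xleftarrow{\rho_A} R_A)$ implies $\sigma\cdot\alpha \in \mathrm{Syz}(B \xrightarrow{\gamma_B} \Omega_B \xleftarrow{\rho_B} R_B)$; composition and identities are those of $\mathbf{P}$. The ideal $\mathbf{I}(\mathbf{P})$ of $\mathrm{Aux}(\mathbf{P})$ consists of the morphisms $\alpha$ (notation as before) for which there exists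 $\zeta: A \to R_B$ with $\alpha\cdot\gamma_B = \zeta\cdot\rho_B$. $\mathcal{Q}(\mathbf{P}) := \mathrm{Aux}(\mathbf{P})/\mathbf{I}(\mathbf{P})$ is the additive quotient category; the class of a morphism $\alpha$ of $\mathrm{Aux}(\mathbf{P})$ is denoted $\overline{\alpha}$. *)

theory Defs
  imports "HOL-Algebra.Coset"
begin

text \<open>
  Categories are given by hom-sets indexed by source and target; hom-sets of different pairs of
  objects may overlap (a morphism of P can be a morphism between several cospans). Composition is
  diagrammatic: for f from X to Y and g from Y to Z, the composite is \<open>Cmp C X Y Z f g\<close>.
\<close>

record ('o, 'm) precat =
  Obj :: "'o set"
  Hom :: "'o \<Rightarrow> 'o \<Rightarrow> 'm set"
  Idn :: "'o \<Rightarrow> 'm"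
  Cmp :: "'o \<Rightarrow> 'o \<Rightarrow> 'o \<Rightarrow> 'm \<Rightarrow> 'm \<Rightarrow> 'm"
  Add :: "'o \<Rightarrow> 'o \<Rightarrow> 'm \<Rightarrow> 'm \<Rightarrow> 'm"
  Zero :: "'o \<Rightarrow> 'o \<Rightarrow> 'm"

definition hom_group :: "('o, 'm) precat \<Rightarrow> 'o \<Rightarrow> 'o \<Rightarrow> 'm monoid" where
  "hom_group C X Y = \<lparr>carrier = Hom C X Y, mult = Add C X Y, one = Zero C X Y\<rparr>"

locale preadditive_category =
  fixes C :: "('o, 'm) precat"
  assumes Idn_in: "X \<in> Obj C \<Longrightarrow> Idn C X \<in> Hom C X X"
    and Cmp_in: "\<lbrakk>X \<in> Obj C; Y \<in> Obj C; Z \<in> Obj C; f \<in> Hom C X Y; g \<in> Hom C Y Z\<rbrakk>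
      \<Longrightarrow> Cmp C X Y Z f g \<in> Hom C X Z"
    and Idn_Cmp: "\<lbrakk>X \<in> Obj C; Y \<in> Obj C; f \<in> Hom C X Y\<rbrakk> \<Longrightarrow> Cmp C X X Y (Idn C X) f = f"
    and Cmp_Idn: "\<lbrakk>X \<in> Obj C; Y \<in> Obj C; f \<in> Hom C X Y\<rbrakk> \<Longrightarrow> Cmp C X Y Y f (Idn C Y) = f"
    and Cmp_assoc: "\<lbrakk>W \<in> Obj C; X \<in> Obj C; Y \<in> Obj C; Z \<in> Obj C;
        f \<in> Hom C W X; g \<in> Hom C X Y; h \<in> Hom C Y Z\<rbrakk>
      \<Longrightarrow> Cmp C W Y Z (Cmp C W X Y f g) h = Cmp C W X Z f (Cmp C X Y Z g h)"
    and hom_comm_group: "\<lbrakk>X \<in> Obj C; Y \<in> Obj C\<rbrakk> \<Longrightarrow> comm_group (hom_group C X Y)"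
    and Cmp_Add_left: "\<lbrakk>X \<in> Obj C; Y \<in> Obj C; Z \<in> Obj C;
        f \<in> Hom C X Y; f' \<in> Hom C X Y; g \<in> Hom C Y Z\<rbrakk>
      \<Longrightarrow> Cmp C X Y Z (Add C X Y f f') g = Add C X Z (Cmp C X Y Z f g) (Cmp C X Y Z f' g)"
    and Cmp_Add_right: "\<lbrakk>X \<in> Obj C; Y \<in> Obj C; Z \<in> Obj C;
        f \<in> Hom C X Y; g \<in> Hom C Y Z; g' \<in> Hom C Y Z\<rbrakk>
      \<Longrightarrow> Cmp C X Y Z f (Add C Y Z g g') = Add C X Z (Cmp C X Y Z f g) (Cmp C X Y Z f g')"

definition zero_object :: "('o, 'm) precat \<Rightarrow> 'o \<Rightarrow> bool" where
  "zero_object C N \<longleftrightarrow> N \<in> Obj C \<and>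
    (\<forall>X \<in> Obj C. (\<exists>!f. f \<in> Hom C N X) \<and> (\<exists>!f. f \<in> Hom C X N))"

definition direct_sum ::
  "('o, 'm) precat \<Rightarrow> 'o \<Rightarrow> 'o \<Rightarrow> 'o \<Rightarrow> 'm \<Rightarrow> 'm \<Rightarrow> 'm \<Rightarrow> 'm \<Rightarrow> bool" where
  "direct_sum C X Y S \<iota>1 \<iota>2 \<pi>1 \<pi>2 \<longleftrightarrow>
    S \<in> Obj C \<and>
    \<iota>1 \<in> Hom C X S \<and> \<iota>2 \<in> Hom C Y S \<and> \<pi>1 \<in> Hom C S X \<and> \<pi>2 \<in> Hom C S Y \<and>
    Cmp C X S X \<iota>1 \<pi>1 = Idn C X \<and> Cmp C Y S Y \<iota>2 \<pi>2 = Idn C Y \<and>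
    Cmp C X S Y \<iota>1 \<pi>2 = Zero C X Y \<and> Cmp C Y S X \<iota>2 \<pi>1 = Zero C Y X \<and>
    Add C S S (Cmp C S X S \<pi>1 \<iota>1) (Cmp C S Y S \<pi>2 \<iota>2) = Idn C S"

locale additive_category = preadditive_category C for C :: "('o, 'm) precat" +
  assumes ex_zero_object: "\<exists>N. zero_object C N"
    and ex_direct_sum: "\<lbrakk>X \<in> Obj C; Y \<in> Obj C\<rbrakk>
      \<Longrightarrow> \<exists>S \<iota>1 \<iota>2 \<pi>1 \<pi>2. direct_sum C X Y S \<iota>1 \<iota>2 \<pi>1 \<pi>2"

definition epimorphism :: "('o, 'm) precat \<Rightarrow> 'o \<Rightarrow> 'o \<Rightarrow> 'm \<Rightarrow> bool" where
  "epimorphism C X Y f \<longleftrightarrow> f \<in> Hom C X Y \<and>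
    (\<forall>Z \<in> Obj C. \<forall>g \<in> Hom C Y Z. \<forall>h \<in> Hom C Y Z.
      Cmp C X Y Z f g = Cmp C X Y Z f h \<longrightarrow> g = h)"

definition test_morphism ::
  "('o, 'm) precat \<Rightarrow> 'o \<Rightarrow> 'o \<Rightarrow> 'o \<Rightarrow> 'm \<Rightarrow> 'm \<Rightarrow> bool" where
  "test_morphism C X Y T f t \<longleftrightarrow> t \<in> Hom C X T \<and>
    (\<forall>K \<in> Obj C. \<forall>k \<in> Hom C K X.
      Cmp C K X Y k f = Zero C K Y \<longrightarrow> Cmp C K X T k t = Zero C K T)"

definition is_colift ::
  "('o, 'm) precat \<Rightarrow> 'o \<Rightarrow> 'o \<Rightarrow> 'o \<Rightarrow> 'm \<Rightarrow> 'm \<Rightarrow> 'm \<Rightarrow> bool" where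
  "is_colift C X Y T f t u \<longleftrightarrow> u \<in> Hom C Y T \<and> Cmp C X Y T f u = t"

text \<open>\<open>Cospan A \<gamma> \<Omega> \<rho> R\<close> stands for \<open>A \<rightarrow> \<Omega> \<leftarrow> R\<close>, with legs \<open>\<gamma>\<close> and \<open>\<rho>\<close>.\<close>

datatype ('o, 'm) cospan =
  Cospan (src: 'o) (gam: 'm) (apex: 'o) (rho: 'm) (rel: 'o)

definition cospans :: "('o, 'm) precat \<Rightarrow> ('o, 'm) cospan set" where
  "cospans P = {c. src c \<in> Obj P \<and> apex c \<in> Obj P \<and> rel c \<in> Obj P \<and>
    gam c \<in> Hom P (src c) (apex c) \<and> rho c \<in> Hom P (rel c) (apex c)}"

text \<open>The objects of the category of syzygies, as pairs of \<open>S\<close> and \<open>\<sigma> : S \<rightarrow> A\<close>.\<close>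

definition Syz :: "('o, 'm) precat \<Rightarrow> ('o, 'm) cospan \<Rightarrow> ('o \<times> 'm) set" where
  "Syz P c = {(S, \<sigma>). S \<in> Obj P \<and> \<sigma> \<in> Hom P S (src c) \<and>
    (\<exists>\<omega> \<in> Hom P S (rel c).
      Cmp P S (src c) (apex c) \<sigma> (gam c) = Cmp P S (rel c) (apex c) \<omega> (rho c))}"

definition Aux :: "('o, 'm) precat \<Rightarrow> (('o, 'm) cospan, 'm) precat" where
  "Aux P = \<lparr>
    Obj = cospans P,
    Hom = (\<lambda>a b. {\<alpha> \<in> Hom P (src a) (src b).
      \<forall>(S, \<sigma>) \<in> Syz P a. (S, Cmp P S (src a) (src b) \<sigma> \<alpha>) \<in> Syz P b}),
    Idn = (\<lambda>a. Idn P (src a)),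
    Cmp = (\<lambda>a b c. Cmp P (src a) (src b) (src c)),
    Add = (\<lambda>a b. Add P (src a) (src b)),
    Zero = (\<lambda>a b. Zero P (src a) (src b))\<rparr>"

definition Idl :: "('o, 'm) precat \<Rightarrow> ('o, 'm) cospan \<Rightarrow> ('o, 'm) cospan \<Rightarrow> 'm set" where
  "Idl P a b = {\<alpha> \<in> Hom (Aux P) a b. \<exists>\<zeta> \<in> Hom P (src a) (rel b).
    Cmp P (src a) (src b) (apex b) \<alpha> (gam b) = Cmp P (src a) (rel b) (apex b) \<zeta> (rho b)}"

definition cls :: "('o, 'm) precat \<Rightarrow> ('o, 'm) cospan \<Rightarrow> ('o, 'm) cospan \<Rightarrow> 'm \<Rightarrow> 'm set" where
  "cls P a b \<alpha> = Idl P a b #>\<^bsub>hom_group (Aux P) a b\<^esub> \<alpha>"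

text \<open>
  The composite of two classes is the class of the composite of any representatives; as in
  \<open>rcoset_mult\<close> for quotient rings it is written as the union over all representatives.
\<close>

definition Quo :: "('o, 'm) precat \<Rightarrow> (('o, 'm) cospan, 'm set) precat" where
  "Quo P = \<lparr>
    Obj = Obj (Aux P),
    Hom = (\<lambda>a b. carrier (hom_group (Aux P) a b Mod Idl P a b)),
    Idn = (\<lambda>a. cls P a a (Idn (Aux P) a)),
    Cmp = (\<lambda>a b c F G. \<Union>f \<in> F. \<Union>g \<in> G. cls P a c (Cmp (Aux P) a b c f g)),
    Add = (\<lambda>a b. mult (hom_group (Aux P) a b Mod Idl P a b)),
    Zero = (\<lambda>a b. one (hom_group (Aux P) a b Mod Idl P a b))\<rparr>"

end

theory Submission
  imports Defs
begin

text \<open>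
  For the first claim, the identity of \<open>B\<close> is a morphism from \<open>B \<rightarrow> \<Omega>\<^sub>B \<leftarrow> R\<^sub>B\<close> to
  \<open>B \<rightarrow> \<Omega>\<^sub>B \<leftarrow> R\<^sub>B \<oplus> A\<close>, where the new right leg has components \<open>\<rho>\<^sub>B\<close> and
  \<open>\<alpha> \<cdot> \<gamma>\<^sub>B\<close>. Its class is annihilated by precomposition with the epimorphism \<open>\<alpha>\<close>, so it is zero,
  and a witness for that is the required \<open>\<zeta>\<close>.

  For the second claim, every morphism \<open>S \<rightarrow> A\<close> of \<open>P\<close> is a morphism from the
  cospan \<open>S \<rightarrow> S \<leftarrow> S\<close> with legs \<open>id\<close> and \<open>0\<close>, whose only syzygies are zero. Hence a test
  morphism \<open>\<tau>\<close> sends every \<open>\<kappa> : S \<rightarrow> A\<close> for which \<open>\<kappa> \<cdot> \<alpha>\<close> is a syzygy of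
  \<open>B\<close> to a syzygy of \<open>T\<close>. Taking \<open>\<kappa> = \<sigma> \<cdot> \<zeta>\<^sub>2\<close> for a syzygy \<open>\<sigma>\<close> of \<open>B\<close> gives
  well-definedness, and \<open>\<kappa> = \<alpha> \<cdot> \<zeta>\<^sub>2 - id\<close> gives the colift equation.
\<close>

section \<open>Selectors of the constructed categories\<close>

lemma Cmp_Aux [simp]: "Cmp (Aux P) a b c = Cmp P (src a) (src b) (src c)"
  and Add_Aux [simp]: "Add (Aux P) a b = Add P (src a) (src b)"
  and Zero_Aux [simp]: "Zero (Aux P) a b = Zero P (src a) (src b)"
  and Obj_Quo [simp]: "Obj (Quo P) = cospans P"
  and Zero_Quo: "Zero (Quo P) a b = Idl P a b"
  and Hom_Quo: "Hom (Quo P) a b = cls P a b ` Hom (Aux P) a b"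
  by (auto simp: Aux_def Quo_def cls_def hom_group_def FactGroup_def RCOSETS_def)

lemma Hom_Aux_iff: "\<alpha> \<in> Hom (Aux P) a b \<longleftrightarrow> \<alpha> \<in> Hom P (src a) (src b) \<and>
    (\<forall>S \<sigma>. (S, \<sigma>) \<in> Syz P a \<longrightarrow> (S, Cmp P S (src a) (src b) \<sigma> \<alpha>) \<in> Syz P b)"
  by (auto simp: Aux_def)

text \<open>The \<open>\<zeta>\<close> required by \<open>Idl\<close> is a syzygy witness for
  \<open>\<alpha>\<close> itself, seen as a morphism into \<open>src b\<close>. Closure properties
  of the ideal thereby reduce to those of \<open>Syz\<close>.\<close>

lemma Idl_iff_Syz:
  assumes "a \<in> cospans P"
  shows "\<alpha> \<in> Idl P a b \<longleftrightarrow> \<alpha> \<in> Hom (Aux P) a b \<and> (src a, \<alpha>) \<in> Syz P b"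
  using assms by (auto simp: Idl_def Syz_def cospans_def Hom_Aux_iff)

section \<open>Arithmetic in hom-groups\<close>

lemma mult_hom_group [simp]: "mult (hom_group C X Y) = Add C X Y"
  and one_hom_group [simp]: "one (hom_group C X Y) = Zero C X Y"
  and carrier_hom_group [simp]: "carrier (hom_group C X Y) = Hom C X Y"
  by (simp_all add: hom_group_def)

text \<open>The record \<open>precat\<close> has no field for negation, so it is recovered as the
  inverse in the hom-group.\<close>

definition Neg :: "('o, 'm) precat \<Rightarrow> 'o \<Rightarrow> 'o \<Rightarrow> 'm \<Rightarrow> 'm" where
  "Neg C X Y f = inv\<^bsub>hom_group C X Y\<^esub> f"

context preadditive_category
begin

lemma hom_group: "\<lbrakk>X \<in> Obj C; Y \<in> Obj C\<rbrakk> \<Longrightarrow> group (hom_group C X Y)"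
  using hom_comm_group comm_group.axioms(2) by blast

lemma Add_in: "\<lbrakk>X \<in> Obj C; Y \<in> Obj C; f \<in> Hom C X Y; g \<in> Hom C X Y\<rbrakk> \<Longrightarrow> Add C X Y f g \<in> Hom C X Y"
  using monoid.m_closed[OF group.is_monoid[OF hom_group]] by simp

lemma Zero_in: "\<lbrakk>X \<in> Obj C; Y \<in> Obj C\<rbrakk> \<Longrightarrow> Zero C X Y \<in> Hom C X Y"
  using monoid.one_closed[OF group.is_monoid[OF hom_group]] by simp

lemma Neg_in: "\<lbrakk>X \<in> Obj C; Y \<in> Obj C; f \<in> Hom C X Y\<rbrakk> \<Longrightarrow> Neg C X Y f \<in> Hom C X Y"
  unfolding Neg_def using group.inv_closed[OF hom_group] by simp

lemma Add_Zero: "\<lbrakk>X \<in> Obj C; Y \<in> Obj C; f \<in> Hom C X Y\<rbrakk> \<Longrightarrow> Add C X Y f (Zero C X Y) = f"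
  using monoid.r_one[OF group.is_monoid[OF hom_group]] by simp

lemma Zero_Add: "\<lbrakk>X \<in> Obj C; Y \<in> Obj C; f \<in> Hom C X Y\<rbrakk> \<Longrightarrow> Add C X Y (Zero C X Y) f = f"
  using monoid.l_one[OF group.is_monoid[OF hom_group]] by simp

lemma Add_Neg: "\<lbrakk>X \<in> Obj C; Y \<in> Obj C; f \<in> Hom C X Y\<rbrakk> \<Longrightarrow> Add C X Y f (Neg C X Y f) = Zero C X Y"
  unfolding Neg_def using group.r_inv[OF hom_group] by simp

lemma Neg_Add: "\<lbrakk>X \<in> Obj C; Y \<in> Obj C; f \<in> Hom C X Y\<rbrakk> \<Longrightarrow> Add C X Y (Neg C X Y f) f = Zero C X Y"
  unfolding Neg_def using group.l_inv[OF hom_group] by simp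

lemma Add_assoc: "\<lbrakk>X \<in> Obj C; Y \<in> Obj C; f \<in> Hom C X Y; g \<in> Hom C X Y; h \<in> Hom C X Y\<rbrakk>
    \<Longrightarrow> Add C X Y (Add C X Y f g) h = Add C X Y f (Add C X Y g h)"
  using monoid.m_assoc[OF group.is_monoid[OF hom_group]] by simp

lemma Add_commute: "\<lbrakk>X \<in> Obj C; Y \<in> Obj C; f \<in> Hom C X Y; g \<in> Hom C X Y\<rbrakk>
    \<Longrightarrow> Add C X Y f g = Add C X Y g f"
  using comm_monoid.m_comm[OF comm_group.axioms(1)[OF hom_comm_group]] by simp

lemma Neg_unique:
  assumes "X \<in> Obj C" "Y \<in> Obj C" "f \<in> Hom C X Y" "g \<in> Hom C X Y" "Add C X Y f g = Zero C X Y"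
  shows "f = Neg C X Y g"
  unfolding Neg_def using group.inv_equality[OF hom_group, of X Y f g] assms by simp

text \<open>Serves composition with zero: by biadditivity such a composite equals its own
  double.\<close>

lemma eq_Zero_if_idem:
  assumes "X \<in> Obj C" "Y \<in> Obj C" "f \<in> Hom C X Y" "Add C X Y f f = f"
  shows "f = Zero C X Y"
  using group.l_cancel_one[OF hom_group, of X Y f f] assms by simp

lemma Cmp_Zero_left:
  assumes "X \<in> Obj C" "Y \<in> Obj C" "Z \<in> Obj C" "g \<in> Hom C Y Z"
  shows "Cmp C X Y Z (Zero C X Y) g = Zero C X Z"
  using assms by (intro eq_Zero_if_idem) (simp_all add: Cmp_in Zero_in Add_Zero flip: Cmp_Add_left)

lemma Cmp_Zero_right:
  assumes "X \<in> Obj C" "Y \<in> Obj C" "Z \<in> Obj C" "f \<in> Hom C X Y"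
  shows "Cmp C X Y Z f (Zero C Y Z) = Zero C X Z"
  using assms by (intro eq_Zero_if_idem) (simp_all add: Cmp_in Zero_in Add_Zero flip: Cmp_Add_right)

lemma Cmp_Neg_left:
  assumes "X \<in> Obj C" "Y \<in> Obj C" "Z \<in> Obj C" "f \<in> Hom C X Y" "g \<in> Hom C Y Z"
  shows "Cmp C X Y Z (Neg C X Y f) g = Neg C X Z (Cmp C X Y Z f g)"
  using assms
  by (intro Neg_unique) (simp_all add: Neg_in Cmp_in Neg_Add Cmp_Zero_left flip: Cmp_Add_left)

lemma Cmp_Neg_right:
  assumes "X \<in> Obj C" "Y \<in> Obj C" "Z \<in> Obj C" "f \<in> Hom C X Y" "g \<in> Hom C Y Z"
  shows "Cmp C X Y Z f (Neg C Y Z g) = Neg C X Z (Cmp C X Y Z f g)"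
  using assms
  by (intro Neg_unique) (simp_all add: Neg_in Cmp_in Neg_Add Cmp_Zero_right flip: Cmp_Add_right)

section \<open>Syzygies of a cospan and their closure properties\<close>

lemma cospanD:
  assumes "c \<in> cospans C"
  shows "src c \<in> Obj C" "apex c \<in> Obj C" "rel c \<in> Obj C"
    "gam c \<in> Hom C (src c) (apex c)" "rho c \<in> Hom C (rel c) (apex c)"
  using assms by (auto simp: cospans_def)

lemma Syz_Zero:
  assumes "c \<in> cospans C" "S \<in> Obj C"
  shows "(S, Zero C S (src c)) \<in> Syz C c"
  using assms cospanD[OF assms(1)]
  by (auto simp: Syz_def Zero_in Cmp_Zero_left intro!: bexI[of _ "Zero C S (rel c)"])

lemma Syz_Add:
  assumes "c \<in> cospans C" "(S, \<sigma>) \<in> Syz C c" "(S, \<sigma>') \<in> Syz C c"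
  shows "(S, Add C S (src c) \<sigma> \<sigma>') \<in> Syz C c"
proof -
  obtain \<omega> \<omega>' where "\<omega> \<in> Hom C S (rel c)" "\<omega>' \<in> Hom C S (rel c)"
    "Cmp C S (src c) (apex c) \<sigma> (gam c) = Cmp C S (rel c) (apex c) \<omega> (rho c)"
    "Cmp C S (src c) (apex c) \<sigma>' (gam c) = Cmp C S (rel c) (apex c) \<omega>' (rho c)"
    using assms by (auto simp: Syz_def)
  then show ?thesis
    using assms cospanD[OF assms(1)]
    by (auto simp: Syz_def Add_in Cmp_Add_left intro!: bexI[of _ "Add C S (rel c) \<omega> \<omega>'"])
qed

lemma Syz_Neg:
  assumes "c \<in> cospans C" "(S, \<sigma>) \<in> Syz C c"
  shows "(S, Neg C S (src c) \<sigma>) \<in> Syz C c"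
proof -
  obtain \<omega> where "\<omega> \<in> Hom C S (rel c)"
    "Cmp C S (src c) (apex c) \<sigma> (gam c) = Cmp C S (rel c) (apex c) \<omega> (rho c)"
    using assms by (auto simp: Syz_def)
  then show ?thesis
    using assms cospanD[OF assms(1)]
    by (auto simp: Syz_def Neg_in Cmp_Neg_left intro!: bexI[of _ "Neg C S (rel c) \<omega>"])
qed

lemma Syz_precomp:
  assumes "c \<in> cospans C" "S' \<in> Obj C" "f \<in> Hom C S' S" "(S, \<sigma>) \<in> Syz C c"
  shows "(S', Cmp C S' S (src c) f \<sigma>) \<in> Syz C c"
proof -
  obtain \<omega> where "\<omega> \<in> Hom C S (rel c)"
    "Cmp C S (src c) (apex c) \<sigma> (gam c) = Cmp C S (rel c) (apex c) \<omega> (rho c)"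
    using assms by (auto simp: Syz_def)
  then show ?thesis
    using assms cospanD[OF assms(1)]
    by (auto simp: Syz_def Cmp_in Cmp_assoc intro!: bexI[of _ "Cmp C S' S (rel c) f \<omega>"])
qed

lemma Syz_in:
  assumes "(S, \<sigma>) \<in> Syz C c"
  shows "S \<in> Obj C" "\<sigma> \<in> Hom C S (src c)"
  using assms by (auto simp: Syz_def)

section \<open>Morphisms and hom-groups of \<open>Aux\<close>\<close>

lemma Hom_AuxI:
  assumes "\<alpha> \<in> Hom C (src a) (src b)"
    and "\<And>S \<sigma>. \<lbrakk>(S, \<sigma>) \<in> Syz C a; S \<in> Obj C; \<sigma> \<in> Hom C S (src a)\<rbrakk>
      \<Longrightarrow> (S, Cmp C S (src a) (src b) \<sigma> \<alpha>) \<in> Syz C b"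
  shows "\<alpha> \<in> Hom (Aux C) a b"
  using assms Syz_in unfolding Hom_Aux_iff by blast

lemma Aux_Cmp_in:
  assumes "a \<in> cospans C" "b \<in> cospans C" "c \<in> cospans C"
    and "f \<in> Hom (Aux C) a b" "g \<in> Hom (Aux C) b c"
  shows "Cmp C (src a) (src b) (src c) f g \<in> Hom (Aux C) a c"
  unfolding Hom_Aux_iff
proof (intro conjI allI impI)
  show "Cmp C (src a) (src b) (src c) f g \<in> Hom C (src a) (src c)"
    using assms by (auto simp: Hom_Aux_iff intro!: Cmp_in cospanD)
next
  fix S \<sigma> assume S: "(S, \<sigma>) \<in> Syz C a"
  have "(S, Cmp C S (src b) (src c) (Cmp C S (src a) (src b) \<sigma> f) g) \<in> Syz C c"
    using assms S by (auto simp: Hom_Aux_iff)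
  then show "(S, Cmp C S (src a) (src c) \<sigma> (Cmp C (src a) (src b) (src c) f g)) \<in> Syz C c"
    using assms Syz_in[OF S] by (simp add: Hom_Aux_iff Cmp_assoc cospanD)
qed

lemma Aux_Zero_in:
  "\<lbrakk>a \<in> cospans C; b \<in> cospans C\<rbrakk> \<Longrightarrow> Zero C (src a) (src b) \<in> Hom (Aux C) a b"
  by (rule Hom_AuxI) (simp_all add: Zero_in Cmp_Zero_right cospanD Syz_Zero)

lemma Aux_Add_in:
  "\<lbrakk>a \<in> cospans C; b \<in> cospans C; f \<in> Hom (Aux C) a b; g \<in> Hom (Aux C) a b\<rbrakk>
    \<Longrightarrow> Add C (src a) (src b) f g \<in> Hom (Aux C) a b"
  by (rule Hom_AuxI) (simp_all add: Hom_Aux_iff Add_in Cmp_Add_right cospanD Syz_Add)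

lemma Aux_Neg_in:
  "\<lbrakk>a \<in> cospans C; b \<in> cospans C; f \<in> Hom (Aux C) a b\<rbrakk>
    \<Longrightarrow> Neg C (src a) (src b) f \<in> Hom (Aux C) a b"
  by (rule Hom_AuxI) (simp_all add: Hom_Aux_iff Neg_in Cmp_Neg_right cospanD Syz_Neg)

lemma Aux_hom_group:
  assumes "a \<in> cospans C" "b \<in> cospans C"
  shows "group (hom_group (Aux C) a b)"
proof (rule groupI; simp add: assms Aux_Zero_in Aux_Add_in)
  fix f assume f: "f \<in> Hom (Aux C) a b"
  then show "Add C (src a) (src b) (Zero C (src a) (src b)) f = f"
    using assms by (simp add: Hom_Aux_iff Zero_Add cospanD)
  show "\<exists>g \<in> Hom (Aux C) a b. Add C (src a) (src b) g f = Zero C (src a) (src b)"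
    using assms f Aux_Neg_in[OF assms f]
    by (intro bexI[of _ "Neg C (src a) (src b) f"]) (auto simp: Hom_Aux_iff Neg_Add cospanD)
next
  fix f g h assume "f \<in> Hom (Aux C) a b" "g \<in> Hom (Aux C) a b" "h \<in> Hom (Aux C) a b"
  then show "Add C (src a) (src b) (Add C (src a) (src b) f g) h =
      Add C (src a) (src b) f (Add C (src a) (src b) g h)"
    using assms by (simp add: Hom_Aux_iff Add_assoc cospanD)
qed

section \<open>The two-sided ideal \<open>Idl\<close>\<close>

lemma Idl_subgroup:
  assumes "a \<in> cospans C" "b \<in> cospans C"
  shows "subgroup (Idl C a b) (hom_group (Aux C) a b)"
proof (rule group.subgroupI[OF Aux_hom_group[OF assms]])
  show "Idl C a b \<subseteq> carrier (hom_group (Aux C) a b)"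
    by (auto simp: Idl_def)
  show "Idl C a b \<noteq> {}"
    using assms Aux_Zero_in[OF assms] Syz_Zero[OF assms(2), of "src a"]
    by (auto simp: Idl_iff_Syz cospanD)
next
  fix f assume f: "f \<in> Idl C a b"
  \<comment> \<open>\<open>Aux C\<close> takes its addition and zero from \<open>C\<close>, so
    inverses are negations in \<open>C\<close>.\<close>
  have "inv\<^bsub>hom_group (Aux C) a b\<^esub> f = Neg C (src a) (src b) f"
    using assms f
    by (intro group.inv_equality[OF Aux_hom_group[OF assms]])
      (auto simp: Idl_def Aux_Neg_in Hom_Aux_iff[THEN iffD1] Neg_Add cospanD)
  then show "inv\<^bsub>hom_group (Aux C) a b\<^esub> f \<in> Idl C a b"
    using assms f by (auto simp: Idl_iff_Syz Aux_Neg_in Syz_Neg)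
next
  fix f g assume "f \<in> Idl C a b" "g \<in> Idl C a b"
  then show "f \<otimes>\<^bsub>hom_group (Aux C) a b\<^esub> g \<in> Idl C a b"
    using assms by (auto simp: Idl_iff_Syz Aux_Add_in Syz_Add)
qed

text \<open>\<open>f\<close> is a syzygy of \<open>b\<close>, and \<open>g\<close>, as a morphism of
  \<open>Aux C\<close>, carries syzygies of \<open>b\<close> to syzygies of
  \<open>c\<close>.\<close>

lemma Idl_Cmp_right:
  assumes "a \<in> cospans C" "b \<in> cospans C" "c \<in> cospans C" "f \<in> Idl C a b" "g \<in> Hom (Aux C) b c"
  shows "Cmp C (src a) (src b) (src c) f g \<in> Idl C a c"
  using assms by (auto simp: Idl_iff_Syz Aux_Cmp_in) (simp add: Hom_Aux_iff)

text \<open>Here \<open>g\<close> is the syzygy, and \<open>Syz_precomp\<close> pulls it back along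
  \<open>f\<close>.\<close>

lemma Idl_Cmp_left:
  assumes "a \<in> cospans C" "b \<in> cospans C" "c \<in> cospans C" "f \<in> Hom (Aux C) a b" "g \<in> Idl C b c"
  shows "Cmp C (src a) (src b) (src c) f g \<in> Idl C a c"
  using assms by (simp add: Idl_iff_Syz Aux_Cmp_in Syz_precomp cospanD Hom_Aux_iff[of f])

section \<open>Residue classes and their composition\<close>

lemma mem_cls_iff: "f \<in> cls C a b g \<longleftrightarrow> (\<exists>h \<in> Idl C a b. f = Add C (src a) (src b) h g)"
  by (auto simp: cls_def r_coset_def)

lemma cls_eqI:
  assumes "a \<in> cospans C" "b \<in> cospans C" "g \<in> Hom (Aux C) a b" "f \<in> cls C a b g"
  shows "cls C a b f = cls C a b g"
  unfolding cls_def
  using assms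
  by (intro group.repr_independence[OF Aux_hom_group, symmetric] Idl_subgroup) (simp_all add: cls_def)

lemma cls_self:
  assumes "a \<in> cospans C" "b \<in> cospans C" "f \<in> Hom (Aux C) a b"
  shows "f \<in> cls C a b f"
  unfolding cls_def
  using assms by (intro group.rcos_self[OF Aux_hom_group] Idl_subgroup) simp_all

lemma cls_in_Quo: "f \<in> Hom (Aux C) a b \<Longrightarrow> cls C a b f \<in> Hom (Quo C) a b"
  by (simp add: Hom_Quo)

text \<open>The zero of the factor group is \<open>Idl C a b\<close> itself, and a coset of a
  subgroup equals the subgroup exactly when its representative lies in it.\<close>

lemma cls_eq_Zero_iff:
  assumes "a \<in> cospans C" "b \<in> cospans C" "f \<in> Hom (Aux C) a b"
  shows "cls C a b f = Zero (Quo C) a b \<longleftrightarrow> f \<in> Idl C a b"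
  using assms cls_self[OF assms]
    group.coset_join2[OF Aux_hom_group, of a b f "Idl C a b"] Idl_subgroup[of a b]
  by (auto simp: Zero_Quo cls_def)

text \<open>Composition in \<open>Quo C\<close> is a union over all representatives. Since the ideal
  is two-sided, every pair of representatives contributes the same class.\<close>

lemma Cmp_cls:
  assumes "a \<in> cospans C" "b \<in> cospans C" "c \<in> cospans C"
    and "f \<in> Hom (Aux C) a b" "g \<in> Hom (Aux C) b c"
  shows "Cmp (Quo C) a b c (cls C a b f) (cls C b c g)
    = cls C a c (Cmp C (src a) (src b) (src c) f g)"
proof -
  let ?fg = "Cmp C (src a) (src b) (src c) f g"
  have "cls C a c (Cmp C (src a) (src b) (src c) f' g') = cls C a c ?fg"
    if f': "f' \<in> cls C a b f" and g': "g' \<in> cls C b c g" for f' g'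
  proof (rule cls_eqI[OF assms(1,3) Aux_Cmp_in[OF assms]])
    obtain i j where i: "i \<in> Idl C a b" "f' = Add C (src a) (src b) i f"
      and j: "j \<in> Idl C b c" "g' = Add C (src b) (src c) j g"
      using f' g' unfolding mem_cls_iff by auto
    have hom: "i \<in> Hom (Aux C) a b" "j \<in> Hom (Aux C) b c" "g' \<in> Hom (Aux C) b c"
      using i j assms by (auto simp: Idl_def Aux_Add_in)
    \<comment> \<open>With \<open>f' = i + f\<close> and \<open>g' = j + g\<close>, the product
      \<open>f' g'\<close> expands to \<open>i g' + f j + f g\<close>; \<open>?h\<close> collects
      the two summands in the ideal.\<close>
    let ?h = "Add C (src a) (src c) (Cmp C (src a) (src b) (src c) i g')
      (Cmp C (src a) (src b) (src c) f j)"
    have "?h \<in> Idl C a c"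
      using subgroup.m_closed[OF Idl_subgroup[OF assms(1,3)]] i j hom assms
      by (simp add: Idl_Cmp_left Idl_Cmp_right)
    moreover have "Cmp C (src a) (src b) (src c) f' g' = Add C (src a) (src c) ?h ?fg"
    proof -
      have "Cmp C (src a) (src b) (src c) f' g'
          = Add C (src a) (src c) (Cmp C (src a) (src b) (src c) i g')
              (Cmp C (src a) (src b) (src c) f g')"
        using hom assms by (simp add: i(2) Hom_Aux_iff Cmp_Add_left cospanD)
      also have "Cmp C (src a) (src b) (src c) f g'
          = Add C (src a) (src c) (Cmp C (src a) (src b) (src c) f j) ?fg"
        using hom assms by (simp add: j(2) Hom_Aux_iff Cmp_Add_right cospanD)
      finally show ?thesis
        using hom assms by (simp add: Hom_Aux_iff Add_assoc cospanD Cmp_in)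
    qed
    ultimately show "Cmp C (src a) (src b) (src c) f' g' \<in> cls C a c ?fg"
      unfolding mem_cls_iff by blast
  qed
  then have "Cmp (Quo C) a b c (cls C a b f) (cls C b c g)
      = (\<Union>f' \<in> cls C a b f. \<Union>g' \<in> cls C b c g. cls C a c ?fg)"
    by (simp add: Quo_def)
  \<comment> \<open>The unions have nonempty index sets, as each class contains its
    representative.\<close>
  also have "\<dots> = cls C a c ?fg"
    using cls_self[OF assms(1,2,4)] cls_self[OF assms(2,3,5)] by blast
  finally show ?thesis .
qed

section \<open>Epimorphisms in the quotient\<close>

text \<open>The classes of \<open>\<beta>\<close> and of the zero morphism both vanish after
  precomposition with the class of \<open>\<alpha>\<close>, so the epimorphism property identifies
  them.\<close>

lemma epimorphism_Idl:
  assumes "a \<in> cospans C" "b \<in> cospans C" "t \<in> cospans C"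
    and "\<alpha> \<in> Hom (Aux C) a b" "\<beta> \<in> Hom (Aux C) b t"
    and epi: "epimorphism (Quo C) a b (cls C a b \<alpha>)"
    and "Cmp C (src a) (src b) (src t) \<alpha> \<beta> \<in> Idl C a t"
  shows "\<beta> \<in> Idl C b t"
proof -
  let ?z = "Zero C (src b) (src t)"
  have z: "?z \<in> Hom (Aux C) b t"
    using assms by (simp add: Aux_Zero_in)
  have z_Idl: "x \<in> cospans C \<Longrightarrow> Zero C (src x) (src t) \<in> Idl C x t" for x
    using subgroup.one_closed[OF Idl_subgroup[of x t]] assms by simp
  have "Cmp (Quo C) a b t (cls C a b \<alpha>) (cls C b t \<beta>) = Zero (Quo C) a t"
    using assms by (simp add: Cmp_cls cls_eq_Zero_iff Aux_Cmp_in)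
  moreover have "Cmp (Quo C) a b t (cls C a b \<alpha>) (cls C b t ?z) = Zero (Quo C) a t"
    using assms z z_Idl by (simp add: Cmp_cls cls_eq_Zero_iff Aux_Cmp_in Idl_Cmp_left)
  ultimately have "cls C b t \<beta> = cls C b t ?z"
    using epi assms z cls_in_Quo[of \<beta> b t] cls_in_Quo[OF z] by (simp add: epimorphism_def)
  also have "\<dots> = Zero (Quo C) b t"
    using assms z z_Idl by (simp add: cls_eq_Zero_iff)
  finally show ?thesis
    using assms by (simp add: cls_eq_Zero_iff)
qed

section \<open>Free cospans and test morphisms\<close>

text \<open>All morphisms from \<open>S\<close> to \<open>src a\<close> in \<open>C\<close> become
  morphisms of \<open>Aux C\<close> out of this cospan, which lets the test property in
  \<open>Quo C\<close> be applied to arbitrary \<open>\<kappa>\<close>.\<close>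

definition free_cospan :: "'o \<Rightarrow> ('o, 'm) cospan" where
  "free_cospan S = Cospan S (Idn C S) S (Zero C S S) S"

lemma src_free_cospan [simp]: "src (free_cospan S) = S"
  by (simp add: free_cospan_def)

lemma free_cospan_in: "S \<in> Obj C \<Longrightarrow> free_cospan S \<in> cospans C"
  by (simp add: free_cospan_def cospans_def Idn_in Zero_in)

lemma Hom_free_cospan:
  assumes "S \<in> Obj C" "a \<in> cospans C" "f \<in> Hom C S (src a)"
  shows "f \<in> Hom (Aux C) (free_cospan S) a"
proof -
  have "(X, Cmp C X S (src a) \<sigma> f) \<in> Syz C a" if "(X, \<sigma>) \<in> Syz C (free_cospan S)" for X \<sigma>
  proof -
    \<comment> \<open>The syzygy equation of the free cospan equates \<open>\<sigma>\<close>
      followed by the identity with some \<open>\<omega>\<close> followed by zero.\<close>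
    have "X \<in> Obj C" "\<sigma> = Zero C X S"
      using that assms by (auto simp: Syz_def free_cospan_def Cmp_Idn Cmp_Zero_right)
    then show ?thesis
      using assms by (simp add: Cmp_Zero_left cospanD Syz_Zero)
  qed
  then show ?thesis
    using assms by (intro Hom_AuxI) simp_all
qed

text \<open>For morphisms of \<open>Aux C\<close> out of \<open>free_cospan S\<close>, vanishing of
  a class is a syzygy condition on \<open>S\<close>, by \<open>Idl_iff_Syz\<close>. The test
  property thus turns syzygies of \<open>b\<close> into syzygies of \<open>t\<close>.\<close>

lemma test_morphism_Syz:
  assumes "a \<in> cospans C" "b \<in> cospans C" "t \<in> cospans C"
    and "\<alpha> \<in> Hom (Aux C) a b" "\<tau> \<in> Hom (Aux C) a t"
    and test: "test_morphism (Quo C) a b t (cls C a b \<alpha>) (cls C a t \<tau>)"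
    and "S \<in> Obj C" "\<kappa> \<in> Hom C S (src a)"
    and syz: "(S, Cmp C S (src a) (src b) \<kappa> \<alpha>) \<in> Syz C b"
  shows "(S, Cmp C S (src a) (src t) \<kappa> \<tau>) \<in> Syz C t"
proof -
  let ?k = "free_cospan S"
  have k: "?k \<in> cospans C" "\<kappa> \<in> Hom (Aux C) ?k a"
    using assms by (simp_all add: free_cospan_in Hom_free_cospan)
  have "Cmp C S (src a) (src b) \<kappa> \<alpha> \<in> Idl C ?k b"
    using assms k Aux_Cmp_in[of ?k a b \<kappa> \<alpha>] by (simp add: Idl_iff_Syz)
  then have "Cmp (Quo C) ?k a b (cls C ?k a \<kappa>) (cls C a b \<alpha>) = Zero (Quo C) ?k b"
    using assms k Aux_Cmp_in[of ?k a b \<kappa> \<alpha>] by (simp add: Cmp_cls cls_eq_Zero_iff)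
  then have "Cmp (Quo C) ?k a t (cls C ?k a \<kappa>) (cls C a t \<tau>) = Zero (Quo C) ?k t"
    using test k cls_in_Quo[OF k(2)] by (simp add: test_morphism_def)
  then have "Cmp C S (src a) (src t) \<kappa> \<tau> \<in> Idl C ?k t"
    using assms k Aux_Cmp_in[of ?k a t \<kappa> \<tau>] by (simp add: Cmp_cls cls_eq_Zero_iff)
  then show ?thesis
    using k by (simp add: Idl_iff_Syz)
qed

section \<open>Existence of the decomposition of \<open>gam b\<close>\<close>

lemma epimorphism_witness:
  assumes "a \<in> cospans C" "b \<in> cospans C" "\<alpha> \<in> Hom (Aux C) a b"
    and epi: "epimorphism (Quo C) a b (cls C a b \<alpha>)"
    and sum: "direct_sum C (rel b) (src a) D \<iota>1 \<iota>2 \<pi>1 \<pi>2"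
  obtains \<zeta> where "\<zeta> \<in> Hom C (src b) D"
    "gam b = Add C (src b) (apex b)
      (Cmp C (src b) (rel b) (apex b) (Cmp C (src b) D (rel b) \<zeta> \<pi>1) (rho b))
      (Cmp C (src b) (src b) (apex b)
        (Cmp C (src b) (src a) (src b) (Cmp C (src b) D (src a) \<zeta> \<pi>2) \<alpha>) (gam b))"
proof -
  note [simp] = cospanD[OF assms(1)] cospanD[OF assms(2)]
  have D [simp]: "D \<in> Obj C" "\<iota>1 \<in> Hom C (rel b) D" "\<iota>2 \<in> Hom C (src a) D"
    "\<pi>1 \<in> Hom C D (rel b)" "\<pi>2 \<in> Hom C D (src a)"
    and \<iota>\<pi>: "Cmp C (rel b) D (rel b) \<iota>1 \<pi>1 = Idn C (rel b)"
    "Cmp C (src a) D (src a) \<iota>2 \<pi>2 = Idn C (src a)"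
    "Cmp C (rel b) D (src a) \<iota>1 \<pi>2 = Zero C (rel b) (src a)"
    "Cmp C (src a) D (rel b) \<iota>2 \<pi>1 = Zero C (src a) (rel b)"
    using sum by (auto simp: direct_sum_def)
  have \<alpha> [simp]: "\<alpha> \<in> Hom C (src a) (src b)"
    using assms(3) by (simp add: Hom_Aux_iff)
  define \<alpha>\<gamma> where "\<alpha>\<gamma> = Cmp C (src a) (src b) (apex b) \<alpha> (gam b)"
  have \<alpha>\<gamma> [simp]: "\<alpha>\<gamma> \<in> Hom C (src a) (apex b)"
    by (simp add: \<alpha>\<gamma>_def Cmp_in)
  \<comment> \<open>The morphism out of the direct sum induced by \<open>rho b\<close> and
    \<open>\<alpha>\<gamma>\<close>.\<close>
  define \<rho> where "\<rho> = Add C D (apex b) (Cmp C D (rel b) (apex b) \<pi>1 (rho b))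
    (Cmp C D (src a) (apex b) \<pi>2 \<alpha>\<gamma>)"
  have \<rho> [simp]: "\<rho> \<in> Hom C D (apex b)"
    by (simp add: \<rho>_def Cmp_in Add_in)
  have Cmp_\<rho>: "Cmp C X D (apex b) f \<rho> = Add C X (apex b)
      (Cmp C X (rel b) (apex b) (Cmp C X D (rel b) f \<pi>1) (rho b))
      (Cmp C X (src a) (apex b) (Cmp C X D (src a) f \<pi>2) \<alpha>\<gamma>)"
    if "X \<in> Obj C" "f \<in> Hom C X D" for X f
    using that by (simp add: \<rho>_def Cmp_Add_right Cmp_in Cmp_assoc)
  have \<iota>\<rho>: "Cmp C (rel b) D (apex b) \<iota>1 \<rho> = rho b"
    "Cmp C (src a) D (apex b) \<iota>2 \<rho> = \<alpha>\<gamma>"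
    by (simp_all add: Cmp_\<rho> \<iota>\<pi> Idn_Cmp Cmp_Zero_left Add_Zero Zero_Add)
  \<comment> \<open>Compared with \<open>b\<close>, the left leg is kept and the relations are
    enlarged by \<open>\<alpha>\<gamma>\<close>, which makes the class of \<open>\<alpha>\<close>
    vanish.\<close>
  define t where "t = Cospan (src b) (gam b) (apex b) \<rho> D"
  have t: "t \<in> cospans C" and t_sel [simp]: "src t = src b" "gam t = gam b" "apex t = apex b"
    "rho t = \<rho>" "rel t = D"
    by (simp_all add: t_def cospans_def)
  \<comment> \<open>Since \<open>\<iota>1\<close> followed by \<open>\<rho>\<close> is
    \<open>rho b\<close>, a witness over \<open>b\<close> followed by \<open>\<iota>1\<close> is a
    witness over \<open>t\<close>.\<close>
  have "(S, \<sigma>) \<in> Syz C t" if \<sigma>: "(S, \<sigma>) \<in> Syz C b" for S \<sigma>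
  proof -
    obtain \<omega> where "S \<in> Obj C" "\<omega> \<in> Hom C S (rel b)" "\<sigma> \<in> Hom C S (src b)"
      "Cmp C S (src b) (apex b) \<sigma> (gam b) = Cmp C S (rel b) (apex b) \<omega> (rho b)"
      using \<sigma> by (auto simp: Syz_def)
    then show ?thesis
      by (auto simp: Syz_def Cmp_in Cmp_assoc \<iota>\<rho> intro!: bexI[of _ "Cmp C S (rel b) D \<omega> \<iota>1"])
  qed
  then have id: "Idn C (src b) \<in> Hom (Aux C) b t"
    by (intro Hom_AuxI) (simp_all add: Idn_in Cmp_Idn)
  \<comment> \<open>The injection \<open>\<iota>2\<close> is a witness, because
    \<open>\<iota>2\<close> followed by \<open>\<rho>\<close> is
    \<open>\<alpha>\<gamma>\<close>.\<close>
  have "(src a, \<alpha>) \<in> Syz C t"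
    using \<iota>\<rho>(2) by (auto simp: Syz_def \<alpha>\<gamma>_def intro!: bexI[of _ \<iota>2])
  then have "Cmp C (src a) (src b) (src t) \<alpha> (Idn C (src b)) \<in> Idl C a t"
    using assms t id Aux_Cmp_in[OF assms(1,2) t assms(3) id] by (simp add: Idl_iff_Syz Cmp_Idn)
  then have "Idn C (src b) \<in> Idl C b t"
    using epimorphism_Idl[OF assms(1,2) t assms(3) id epi] by simp
  \<comment> \<open>The identity lies in the ideal exactly when \<open>gam b\<close> factors through
    the right leg of \<open>t\<close>; the factor is \<open>\<zeta>\<close>.\<close>
  then obtain \<zeta> where \<zeta>: "\<zeta> \<in> Hom C (src b) D" "gam b = Cmp C (src b) D (apex b) \<zeta> \<rho>"
    by (auto simp: Idl_def Idn_Cmp)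
  show thesis
  proof (rule that[OF \<zeta>(1)])
    show "gam b = Add C (src b) (apex b)
      (Cmp C (src b) (rel b) (apex b) (Cmp C (src b) D (rel b) \<zeta> \<pi>1) (rho b))
      (Cmp C (src b) (src b) (apex b)
        (Cmp C (src b) (src a) (src b) (Cmp C (src b) D (src a) \<zeta> \<pi>2) \<alpha>) (gam b))"
      using \<zeta> Cmp_\<rho>[of "src b" \<zeta>]
        Cmp_assoc[of "src b" "src a" "src b" "apex b" "Cmp C (src b) D (src a) \<zeta> \<pi>2" \<alpha> "gam b"]
      by (simp add: \<alpha>\<gamma>_def Cmp_in)
  qed
qed

section \<open>Well-definedness and the colift equation\<close>

text \<open>Precomposing the hypothesis \<open>gam\<close> with \<open>f\<close> shows that the
  negative of \<open>f\<close> followed by \<open>\<zeta>1\<close> is a witness. So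
  \<open>\<xi>\<close> acts as the identity up to syzygies of \<open>b\<close>; this is applied both
  to a syzygy \<open>\<sigma>\<close> and to \<open>\<alpha>\<close>.\<close>

lemma Syz_diff:
  assumes b: "b \<in> cospans C" and S: "S \<in> Obj C" "f \<in> Hom C S (src b)"
    and \<xi>: "\<xi> \<in> Hom C (src b) (src b)" "\<zeta>1 \<in> Hom C (src b) (rel b)"
    and gam: "gam b = Add C (src b) (apex b) (Cmp C (src b) (rel b) (apex b) \<zeta>1 (rho b))
      (Cmp C (src b) (src b) (apex b) \<xi> (gam b))"
  shows "(S, Add C S (src b) (Cmp C S (src b) (src b) f \<xi>) (Neg C S (src b) f)) \<in> Syz C b"
proof -
  note [simp] = cospanD[OF b]
  let ?A = "Add C S (apex b)"
  let ?\<rho> = "Cmp C S (rel b) (apex b) (Cmp C S (src b) (rel b) f \<zeta>1) (rho b)"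
  let ?g = "Cmp C S (src b) (apex b) f (gam b)"
  let ?\<xi> = "Cmp C S (src b) (apex b) (Cmp C S (src b) (src b) f \<xi>) (gam b)"
  have [simp]: "?\<rho> \<in> Hom C S (apex b)" "?g \<in> Hom C S (apex b)" "?\<xi> \<in> Hom C S (apex b)"
    using S \<xi> by (simp_all add: Cmp_in)
  have g: "?g = ?A ?\<rho> ?\<xi>"
    \<comment> \<open>\<open>gam b\<close> occurs on both sides of \<open>gam\<close>, so the
      equation is used for one substitution; as a simplification rule it would loop.\<close>
    using S \<xi> by (subst gam) (simp add: Cmp_Add_right Cmp_in Cmp_assoc)
  \<comment> \<open>Adding \<open>?\<rho>\<close> to the difference of \<open>?\<xi>\<close> and
    \<open>?g\<close> gives \<open>?g\<close> minus itself; \<open>Neg_unique\<close> then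
    identifies the difference with the negative of \<open>?\<rho>\<close>.\<close>
  have "?A (?A ?\<xi> (Neg C S (apex b) ?g)) ?\<rho> = ?A (?A ?\<rho> ?\<xi>) (Neg C S (apex b) ?g)"
    using S Add_commute[of S "apex b" "?A ?\<xi> (Neg C S (apex b) ?g)" ?\<rho>]
    by (simp add: Add_assoc Add_in Neg_in)
  also have "\<dots> = Zero C S (apex b)"
    using S by (simp flip: g add: Add_Neg)
  finally have "?A ?\<xi> (Neg C S (apex b) ?g) = Neg C S (apex b) ?\<rho>"
    using S by (intro Neg_unique) (simp_all add: Add_in Neg_in)
  then show ?thesis
    using S \<xi>
    by (auto simp: Syz_def Add_in Neg_in Cmp_in Cmp_Add_left Cmp_Neg_left
        intro!: bexI[of _ "Neg C S (rel b) (Cmp C S (src b) (rel b) f \<zeta>1)"])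
qed

text \<open>\<open>Syz_diff\<close> supplies syzygies of \<open>b\<close> that factor through
  \<open>\<alpha>\<close>, and \<open>test_morphism_Syz\<close> replaces that last factor by
  \<open>\<tau>\<close> to give syzygies of \<open>t\<close>.\<close>

lemma colift:
  assumes a: "a \<in> cospans C" and b: "b \<in> cospans C" and t: "t \<in> cospans C"
    and \<alpha>: "\<alpha> \<in> Hom (Aux C) a b" and \<tau>: "\<tau> \<in> Hom (Aux C) a t"
    and test: "test_morphism (Quo C) a b t (cls C a b \<alpha>) (cls C a t \<tau>)"
    and \<zeta>: "\<zeta>1 \<in> Hom C (src b) (rel b)" "\<zeta>2 \<in> Hom C (src b) (src a)"
    and gam: "gam b = Add C (src b) (apex b)
      (Cmp C (src b) (rel b) (apex b) \<zeta>1 (rho b))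
      (Cmp C (src b) (src b) (apex b) (Cmp C (src b) (src a) (src b) \<zeta>2 \<alpha>) (gam b))"
  shows "Cmp C (src b) (src a) (src t) \<zeta>2 \<tau> \<in> Hom (Aux C) b t"
    and "is_colift (Quo C) a b t (cls C a b \<alpha>) (cls C a t \<tau>)
      (cls C b t (Cmp C (src b) (src a) (src t) \<zeta>2 \<tau>))"
proof -
  note [simp] = cospanD[OF a] cospanD[OF b] cospanD[OF t]
  have [simp]: "\<alpha> \<in> Hom C (src a) (src b)" "\<tau> \<in> Hom C (src a) (src t)"
    using \<alpha> \<tau> by (simp_all add: Hom_Aux_iff)
  note [simp] = \<zeta>
  let ?\<xi> = "Cmp C (src b) (src a) (src b) \<zeta>2 \<alpha>"
  let ?u = "Cmp C (src b) (src a) (src t) \<zeta>2 \<tau>"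
  have \<xi> [simp]: "?\<xi> \<in> Hom C (src b) (src b)" and u [simp]: "?u \<in> Hom C (src b) (src t)"
    by (simp_all add: Cmp_in)
  note diff = Syz_diff[OF b _ _ \<xi> \<zeta>(1) gam]
  have "(S, Cmp C S (src b) (src t) \<sigma> ?u) \<in> Syz C t" if \<sigma>: "(S, \<sigma>) \<in> Syz C b" for S \<sigma>
  proof -
    note [simp] = Syz_in[OF \<sigma>]
    let ?\<sigma>\<xi> = "Cmp C S (src b) (src b) \<sigma> ?\<xi>"
    have [simp]: "?\<sigma>\<xi> \<in> Hom C S (src b)"
      by (simp add: Cmp_in)
    \<comment> \<open>Adding \<open>\<sigma>\<close> back to the difference from
      \<open>Syz_diff\<close> leaves \<open>?\<sigma>\<xi>\<close>.\<close>
    have "(S, Add C S (src b) (Add C S (src b) ?\<sigma>\<xi> (Neg C S (src b) \<sigma>)) \<sigma>) \<in> Syz C b"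
      by (rule Syz_Add[OF b diff \<sigma>]) simp_all
    then have "(S, ?\<sigma>\<xi>) \<in> Syz C b"
      by (simp add: Add_assoc Neg_in Neg_Add Add_Zero)
    then have "(S, Cmp C S (src a) (src t) (Cmp C S (src b) (src a) \<sigma> \<zeta>2) \<tau>) \<in> Syz C t"
      by (intro test_morphism_Syz[OF a b t \<alpha> \<tau> test]) (simp_all add: Cmp_in Cmp_assoc)
    then show ?thesis
      by (simp add: Cmp_assoc)
  qed
  then show u_Aux: "?u \<in> Hom (Aux C) b t"
    by (simp add: Hom_Aux_iff)
  let ?\<alpha>u = "Cmp C (src a) (src b) (src t) \<alpha> ?u"
  let ?d = "Add C (src a) (src t) ?\<alpha>u (Neg C (src a) (src t) \<tau>)"
  have \<alpha>u: "?\<alpha>u \<in> Hom (Aux C) a t"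
    by (rule Aux_Cmp_in[OF a b t \<alpha> u_Aux])
  have [simp]: "?\<alpha>u \<in> Hom C (src a) (src t)"
    by (simp add: Cmp_in)
  \<comment> \<open>Followed by \<open>\<alpha>\<close>, this is the difference from
    \<open>Syz_diff\<close> for \<open>f = \<alpha>\<close>; followed by \<open>\<tau>\<close>, it
    is \<open>?d\<close>.\<close>
  let ?\<kappa> = "Add C (src a) (src a) (Cmp C (src a) (src b) (src a) \<alpha> \<zeta>2)
    (Neg C (src a) (src a) (Idn C (src a)))"
  have "(src a, Cmp C (src a) (src a) (src b) ?\<kappa> \<alpha>) \<in> Syz C b"
    using diff[of "src a" \<alpha>]
    by (simp add: Cmp_Add_left Cmp_Neg_left Cmp_in Neg_in Idn_in Idn_Cmp Cmp_assoc)
  then have "(src a, Cmp C (src a) (src a) (src t) ?\<kappa> \<tau>) \<in> Syz C t"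
    by (intro test_morphism_Syz[OF a b t \<alpha> \<tau> test]) (simp_all add: Add_in Cmp_in Neg_in Idn_in)
  then have "(src a, ?d) \<in> Syz C t"
    by (simp add: Cmp_Add_left Cmp_Neg_left Cmp_in Neg_in Idn_in Idn_Cmp Cmp_assoc)
  then have "?d \<in> Idl C a t"
    using a t \<alpha>u \<tau> by (simp add: Idl_iff_Syz Aux_Add_in Aux_Neg_in)
  moreover have "?\<alpha>u = Add C (src a) (src t) ?d \<tau>"
    by (simp add: Add_assoc Neg_in Neg_Add Add_Zero)
  ultimately have "cls C a t ?\<alpha>u = cls C a t \<tau>"
    by (intro cls_eqI[OF a t \<tau>]) (auto simp: mem_cls_iff)
  then show "is_colift (Quo C) a b t (cls C a b \<alpha>) (cls C a t \<tau>) (cls C b t ?u)"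
    using a b t \<alpha> u_Aux by (simp add: is_colift_def cls_in_Quo Cmp_cls)
qed

end

text \<open>Morphisms of \<open>Quo P\<close> are given by representatives, which loses nothing by
  \<open>Hom_Quo\<close>. Well-definedness of the composite of \<open>\<zeta>2\<close> and
  \<open>\<tau>\<close> is its membership in \<open>Hom (Aux P) B T\<close>.\<close>

theorem mainTheorem9:
  fixes P :: "('o, 'm) precat"
    and A B :: "('o, 'm) cospan"
    and \<alpha> \<iota>1 \<iota>2 \<pi>1 \<pi>2 :: 'm
    and D :: 'o
  assumes "additive_category P"
    and "A \<in> Obj (Quo P)" and "B \<in> Obj (Quo P)"
    and "\<alpha> \<in> Hom (Aux P) A B"
    and "epimorphism (Quo P) A B (cls P A B \<alpha>)"
    and "direct_sum P (rel B) (src A) D \<iota>1 \<iota>2 \<pi>1 \<pi>2"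
  shows "(\<exists>\<zeta> \<in> Hom P (src B) D. \<exists>\<zeta>1 \<zeta>2.
        \<zeta>1 = Cmp P (src B) D (rel B) \<zeta> \<pi>1 \<and> \<zeta>2 = Cmp P (src B) D (src A) \<zeta> \<pi>2 \<and>
        gam B = Add P (src B) (apex B)
          (Cmp P (src B) (rel B) (apex B) \<zeta>1 (rho B))
          (Cmp P (src B) (src B) (apex B) (Cmp P (src B) (src A) (src B) \<zeta>2 \<alpha>) (gam B))) \<and>
    (\<forall>\<zeta> \<in> Hom P (src B) D. \<forall>\<zeta>1 \<zeta>2.
        \<zeta>1 = Cmp P (src B) D (rel B) \<zeta> \<pi>1 \<and> \<zeta>2 = Cmp P (src B) D (src A) \<zeta> \<pi>2 \<and>
        gam B = Add P (src B) (apex B)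
          (Cmp P (src B) (rel B) (apex B) \<zeta>1 (rho B))
          (Cmp P (src B) (src B) (apex B) (Cmp P (src B) (src A) (src B) \<zeta>2 \<alpha>) (gam B)) \<longrightarrow>
        (\<forall>T \<in> Obj (Quo P). \<forall>\<tau> \<in> Hom (Aux P) A T.
          test_morphism (Quo P) A B T (cls P A B \<alpha>) (cls P A T \<tau>) \<longrightarrow>
            Cmp P (src B) (src A) (src T) \<zeta>2 \<tau> \<in> Hom (Aux P) B T \<and>
            is_colift (Quo P) A B T (cls P A B \<alpha>) (cls P A T \<tau>)
              (cls P B T (Cmp P (src B) (src A) (src T) \<zeta>2 \<tau>))))"
proof -
  interpret additive_category P by fact
  have A: "A \<in> cospans P" and B: "B \<in> cospans P"
    using assms(2,3) by simp_all
  have "D \<in> Obj P" "\<pi>1 \<in> Hom P D (rel B)" "\<pi>2 \<in> Hom P D (src A)"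
    using assms(6) by (auto simp: direct_sum_def)
  then have comp: "Cmp P (src B) D (rel B) \<zeta> \<pi>1 \<in> Hom P (src B) (rel B)"
    "Cmp P (src B) D (src A) \<zeta> \<pi>2 \<in> Hom P (src B) (src A)" if "\<zeta> \<in> Hom P (src B) D" for \<zeta>
    using that cospanD[OF A] cospanD[OF B] by (simp_all add: Cmp_in)
  show ?thesis
  proof (intro conjI ballI allI impI; (elim conjE)?)
    show "\<exists>\<zeta> \<in> Hom P (src B) D. \<exists>\<zeta>1 \<zeta>2.
        \<zeta>1 = Cmp P (src B) D (rel B) \<zeta> \<pi>1 \<and> \<zeta>2 = Cmp P (src B) D (src A) \<zeta> \<pi>2 \<and>
        gam B = Add P (src B) (apex B)
          (Cmp P (src B) (rel B) (apex B) \<zeta>1 (rho B))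
          (Cmp P (src B) (src B) (apex B) (Cmp P (src B) (src A) (src B) \<zeta>2 \<alpha>) (gam B))"
      by (rule epimorphism_witness[OF A B assms(4-6)]) blast
  next
    fix \<zeta> \<zeta>1 \<zeta>2 T \<tau>
    assume "\<zeta> \<in> Hom P (src B) D"
      and eq: "\<zeta>1 = Cmp P (src B) D (rel B) \<zeta> \<pi>1" "\<zeta>2 = Cmp P (src B) D (src A) \<zeta> \<pi>2"
      and gam: "gam B = Add P (src B) (apex B)
          (Cmp P (src B) (rel B) (apex B) \<zeta>1 (rho B))
          (Cmp P (src B) (src B) (apex B) (Cmp P (src B) (src A) (src B) \<zeta>2 \<alpha>) (gam B))"
      and T: "T \<in> Obj (Quo P)" and \<tau>: "\<tau> \<in> Hom (Aux P) A T"
      and test: "test_morphism (Quo P) A B T (cls P A B \<alpha>) (cls P A T \<tau>)"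
    then have "\<zeta>1 \<in> Hom P (src B) (rel B)" "\<zeta>2 \<in> Hom P (src B) (src A)"
      by (simp_all add: comp)
    note colift = colift[OF A B T[simplified] assms(4) \<tau> test this gam]
    show "Cmp P (src B) (src A) (src T) \<zeta>2 \<tau> \<in> Hom (Aux P) B T"
      by (rule colift)
    show "is_colift (Quo P) A B T (cls P A B \<alpha>) (cls P A T \<tau>)
        (cls P B T (Cmp P (src B) (src A) (src T) \<zeta>2 \<tau>))"
      by (rule colift)
  qed
qed

end
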